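(* Let $K_1\subset\mathbb{C}^{n_1}$ and $K_2\subset\mathbb{C}^{n_2}$ be compact and non-pluripolar, and let $S_1\subset\mathbb{R}^{n_1}_+$ and $S_2\subset\mathbb{R}^{n_2}_+$ be compact convex and contain $0$. Then, for all $z=(z_1,z_2)$ with $z_1\in\mathbb{C}^{n_1}$, $z_2\in\mathbb{C}^{n_2}$, $$V^{S_1\times S_2}_{K_1\times K_2}(z)=V^{S_1}_{K_1}(z_1)+V^{S_2}_{K_2}(z_2).$$
   Context: $\mathbb{R}_+=[0,\infty)$, $\mathbb{C}^{*n}=(\mathbb{C}\setminus\{0\})^n$. For compact convex $S\subset\mathbb{R}^n$, $\varphi_S(\xi)=\sup_{x\in S}\langle x,\xi\rangle$ is its supporting function. For $S\subset\mathbb{R}^n_+$ compact convex containing $0$, the logarithmic supporting function is $H_S(z)=\varphi_S(\log|z_1|,\dots,\log|z_n|)$ for $z\in\mathbb{C}^{*n}$, extended to $\mathbb{C}^n$ by $H_S(z)=\varlimsup_{\mathbb{C}^{*n}\ni w\to z}H_S(w)$. The Lelong class $\mathcal{L}^S(\mathbb{C}^n)$ consists of all plurisubharmonic $u$ on $\mathbb{C}^n$ such that $u\le H_S+c_u$ for some constant $c_u$. For compact $K\subset\mathbb{C}^n$, $V^S_K(z)=\sup\{u(z)\,;\,u\in\mathcal{L}^S(\mathbb{C}^n),\ u|_K\le 0\}$. *)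

theory Defs
  imports "HOL-Analysis.Analysis"
begin

text \<open>
  Functions with values in \<open>[-\<infinity>, \<infinity>)\<close> are modelled as \<open>ereal\<close>-valued functions that omit \<open>\<infinity>\<close>.
\<close>

definition usc :: "('a::topological_space \<Rightarrow> ereal) \<Rightarrow> bool" where
  "usc u \<longleftrightarrow> (\<forall>c. open {z. u z < c})"

text \<open>
  The mean of \<open>v\<close> over the circle with centre \<open>a\<close> and radius \<open>r\<close>. Since \<open>e2ennreal\<close> truncates
  negative values to 0, this is the integral of the positive part minus the integral of the
  negative part, divided by \<open>2\<pi>\<close>. If \<open>v\<close> is upper semicontinuous and omits \<open>\<infinity>\<close>, the first integral
  is finite, so the difference is a well-defined element of \<open>[-\<infinity>, \<infinity>)\<close>.
\<close>

definition circle_mean :: "(complex \<Rightarrow> ereal) \<Rightarrow> complex \<Rightarrow> real \<Rightarrow> ereal" where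
  "circle_mean v a r =
     (enn2ereal (\<integral>\<^sup>+t\<in>{0..2*pi}. e2ennreal (v (a + of_real r * cis t)) \<partial>lborel)
      - enn2ereal (\<integral>\<^sup>+t\<in>{0..2*pi}. e2ennreal (- v (a + of_real r * cis t)) \<partial>lborel))
     / ereal (2 * pi)"

text \<open>The constant \<open>-\<infinity>\<close> counts as subharmonic and as plurisubharmonic.\<close>

definition subharmonic :: "(complex \<Rightarrow> ereal) \<Rightarrow> bool" where
  "subharmonic v \<longleftrightarrow>
     (\<forall>z. v z < \<infinity>) \<and> usc v \<and> (\<forall>a r. 0 < r \<longrightarrow> v a \<le> circle_mean v a r)"

definition psh :: "(complex^'n::finite \<Rightarrow> ereal) \<Rightarrow> bool" where
  "psh u \<longleftrightarrow>
     (\<forall>z. u z < \<infinity>) \<and> usc u \<and> (\<forall>a b. subharmonic (\<lambda>\<zeta>. u (a + \<zeta> *s b)))"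

definition pluripolar :: "(complex^'n::finite) set \<Rightarrow> bool" where
  "pluripolar E \<longleftrightarrow> (\<exists>u. psh u \<and> (\<exists>z. u z \<noteq> -\<infinity>) \<and> E \<subseteq> {z. u z = -\<infinity>})"

definition supporting_fun :: "(real^'n::finite) set \<Rightarrow> real^'n \<Rightarrow> ereal" where
  "supporting_fun S \<xi> = (SUP x\<in>S. ereal (x \<bullet> \<xi>))"

definition Cstar :: "(complex^'n::finite) set" where
  "Cstar = {z. \<forall>j. z $ j \<noteq> 0}"

definition log_supporting_fun :: "(real^'n::finite) set \<Rightarrow> complex^'n \<Rightarrow> ereal" where
  "log_supporting_fun S z =
     (let h = (\<lambda>w. supporting_fun S (\<chi> j. ln (cmod (w $ j))))
      in if z \<in> Cstar then h z else Limsup (at z within Cstar) h)"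

definition Lelong_class :: "(real^'n::finite) set \<Rightarrow> (complex^'n \<Rightarrow> ereal) set" where
  "Lelong_class S =
     {u. psh u \<and> (\<exists>c::real. \<forall>z. u z \<le> log_supporting_fun S z + ereal c)}"

definition extremal_fun :: "(real^'n::finite) set \<Rightarrow> (complex^'n) set \<Rightarrow> complex^'n \<Rightarrow> ereal" where
  "extremal_fun S K z = (SUP u\<in>{u \<in> Lelong_class S. \<forall>w\<in>K. u w \<le> 0}. u z)"

text \<open>
  \<open>F\<^sup>m \<times> F\<^sup>n\<close> is identified with \<open>F\<^sup>m\<^sup>+\<^sup>n\<close>, vectors indexed by the disjoint sum of the two index types.
\<close>

definition vec_pair :: "'a^'m::finite \<Rightarrow> 'a^'n::finite \<Rightarrow> 'a^('m + 'n)" where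
  "vec_pair x y = (\<chi> k. case k of Inl i \<Rightarrow> x $ i | Inr j \<Rightarrow> y $ j)"

definition vec_times :: "('a^'m::finite) set \<Rightarrow> ('a^'n::finite) set \<Rightarrow> ('a^('m + 'n)) set" where
  "vec_times A B = {vec_pair x y | x y. x \<in> A \<and> y \<in> B}"

end

theory Submission
  imports Defs
begin

text \<open>
  Write \<open>V\<^sub>1\<close>, \<open>V\<^sub>2\<close>, \<open>V\<close> for the extremal functions of \<open>(S\<^sub>1, K\<^sub>1)\<close>, \<open>(S\<^sub>2, K\<^sub>2)\<close> and of the products.
  Both inequalities rest on the identity
  \<open>H\<^bsub>S\<^sub>1\<times>S\<^sub>2\<^esub>(z\<^sub>1, z\<^sub>2) = H\<^bsub>S\<^sub>1\<^esub>(z\<^sub>1) + H\<^bsub>S\<^sub>2\<^esub>(z\<^sub>2)\<close>, in which all terms are finite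
  (\<open>log_supporting_fun_vec_times\<close>). Where no coordinate vanishes it is the
  additivity of suprema. Elsewhere \<open>H\<^bsub>S\<^esub>\<close> is defined by an upper limit, and upper limits are not
  additive; so the upper limit is first computed (\<open>log_supporting_fun_eq\<close>). An exponent \<open>s \<in> S\<close>
  that is positive in a coordinate where \<open>z\<close> vanishes contributes \<open>s\<^sub>j log |w\<^sub>j| \<rightarrow> -\<infinity>\<close>, and by
  compactness of \<open>S\<close> only the exponents supported on the nonzero coordinates of \<open>z\<close> survive:
  \<open>H\<^bsub>S\<^esub>(z)\<close> is the supremum of \<open>\<Sum> s\<^sub>j log |z\<^sub>j|\<close> over those. Such exponents of a product again form
  a product.

  For \<open>V\<^sub>1 + V\<^sub>2 \<le> V\<close>, if \<open>u\<close> and \<open>v\<close> compete for \<open>V\<^sub>1\<close> and \<open>V\<^sub>2\<close>, then \<open>u(z\<^sub>1) + v(z\<^sub>2)\<close> competes for \<open>V\<close>.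

  For \<open>V \<le> V\<^sub>1 + V\<^sub>2\<close>, let \<open>u\<close> compete for \<open>V\<close>. By the identity and finiteness of \<open>H\<close>, every slice
  of \<open>u\<close> lies in the Lelong class of the corresponding factor. For \<open>y \<in> K\<^sub>2\<close> the slice \<open>u(\<cdot>, y)\<close> is
  nonpositive on \<open>K\<^sub>1\<close>, so \<open>u(z\<^sub>1, y) \<le> V\<^sub>1(z\<^sub>1)\<close>. Hence, when \<open>V\<^sub>1(z\<^sub>1)\<close> is finite, the function
  \<open>u(z\<^sub>1, \<cdot>) - V\<^sub>1(z\<^sub>1)\<close> is nonpositive on \<open>K\<^sub>2\<close> and therefore competes for \<open>V\<^sub>2\<close>. When \<open>V\<^sub>1(z\<^sub>1)\<close> is
  infinite there is nothing to show, since extremal functions are nonnegative.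
\<close>

section \<open>Upper semicontinuous functions\<close>

lemma ereal_add_less_split:
  fixes x y c :: ereal
  assumes "x < \<infinity>" "y < \<infinity>" "x + y < c"
  obtains a b where "x < a" "y < b" "a < \<infinity>" "b < \<infinity>" "a + b \<le> c"
proof -
  obtain d :: real where d: "x + y < ereal d" "ereal d \<le> c"
    using ereal_dense2[OF assms(3)] by (auto intro: less_imp_le)
  have "\<exists>a b. x < ereal a \<and> y < ereal b \<and> a + b \<le> d"
  proof (cases x)
    case (real p)
    show ?thesis
    proof (cases y)
      case (real q)
      then have "p + q < d" using \<open>x = ereal p\<close> d by simp
      then show ?thesis using real \<open>x = ereal p\<close>
        by (intro exI[of _ "p + (d - p - q) / 2"] exI[of _ "q + (d - p - q) / 2"])
          (simp add: field_simps)
    next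
      case MInf
      then show ?thesis using real
        by (intro exI[of _ "p + 1"] exI[of _ "d - (p + 1)"]) simp
    qed (use assms in simp)
  next
    case MInf
    then obtain q where "y < ereal q"
      using assms(2) by (auto simp: less_PInf_Ex_of_nat)
    then show ?thesis using MInf
      by (intro exI[of _ "d - q"] exI[of _ q]) simp
  qed (use assms in simp)
  then obtain a b where ab: "x < ereal a" "y < ereal b" "a + b \<le> d" by blast
  have "ereal a + ereal b \<le> ereal d" using ab(3) by simp
  then have "ereal a + ereal b \<le> c" using d(2) by (rule order_trans)
  with ab show ?thesis by (intro that[of "ereal a" "ereal b"]) auto
qed

text \<open>
  The sublevel set of a sum is the union, over all ways to split the bound, of intersections of
  sublevel sets of the summands.
\<close>

lemma usc_add:
  assumes f: "usc f" "\<And>z. f z < \<infinity>" and g: "usc g" "\<And>z. g z < \<infinity>"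
  shows "usc (\<lambda>z. f z + g z)"
  unfolding usc_def
proof
  fix c
  have "{z. f z + g z < c} = (\<Union>(a, b)\<in>{(a, b). a < \<infinity> \<and> b < \<infinity> \<and> a + b \<le> c}. {z. f z < a} \<inter> {z. g z < b})"
    (is "?L = ?R")
  proof
    show "?L \<subseteq> ?R"
    proof
      fix z assume "z \<in> ?L"
      then obtain a b where "f z < a" "g z < b" "a < \<infinity>" "b < \<infinity>" "a + b \<le> c"
        using ereal_add_less_split[of "f z" "g z" c] f(2) g(2) by auto
      then show "z \<in> ?R" by auto
    qed
    show "?R \<subseteq> ?L"
      by (auto intro: less_le_trans[OF ereal_add_strict_mono2])
  qed
  then show "open {z. f z + g z < c}"
    using f(1) g(1) by (auto simp: usc_def intro!: open_Int)
qed

lemma usc_continuous_comp: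
  assumes "usc u" "continuous_on UNIV A"
  shows "usc (\<lambda>z. u (A z))"
  unfolding usc_def
proof
  fix c
  show "open {z. u (A z) < c}"
    using assms open_vimage[of "{w. u w < c}" A] by (simp add: usc_def vimage_def)
qed

lemma usc_borel_measurable:
  assumes "usc u"
  shows "u \<in> borel_measurable borel"
  using assms by (auto simp: usc_def intro!: borel_measurableI_less)

lemma usc_bounded_above_on_compact:
  assumes "usc u" "\<And>z. u z < \<infinity>" "compact K"
  shows "\<exists>M::nat. \<forall>z\<in>K. u z \<le> ereal (real M)"
proof -
  have "K \<subseteq> (\<Union>n\<in>(UNIV::nat set). {z. u z < ereal (real n)})"
  proof
    fix z
    obtain n where "u z < ereal (real n)"
      using assms(2)[of z] by (auto simp: less_PInf_Ex_of_nat)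
    then show "z \<in> (\<Union>n\<in>(UNIV::nat set). {z. u z < ereal (real n)})" by blast
  qed
  moreover have "open {z. u z < ereal (real n)}" for n :: nat
    using assms(1) by (simp add: usc_def)
  ultimately obtain C where C: "finite C" "K \<subseteq> (\<Union>n\<in>C. {z. u z < ereal (real n)})"
    by (rule_tac compactE_image[OF assms(3), of UNIV "\<lambda>n::nat. {z. u z < ereal (real n)}"])
  show ?thesis
  proof (intro exI[of _ "Max (insert 0 C)"] ballI)
    fix z assume "z \<in> K"
    then obtain n where "n \<in> C" "u z < ereal (real n)" using C by auto
    moreover have "n \<le> Max (insert 0 C)" using C \<open>n \<in> C\<close> by simp
    ultimately show "u z \<le> ereal (real (Max (insert 0 C)))"
      by (rule_tac order_trans[OF less_imp_le]) auto
  qed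
qed

section \<open>Sums and affine pullbacks of plurisubharmonic functions\<close>

text \<open>
  The identity \<open>(x + y)\<^sup>+ - (x + y)\<^sup>- = (x\<^sup>+ - x\<^sup>-) + (y\<^sup>+ - y\<^sup>-)\<close> with the negative parts moved across,
  so that it can be integrated even where negative parts are infinite.
\<close>

lemma e2ennreal_add_parts:
  fixes x y :: ereal
  assumes "x < \<infinity>" "y < \<infinity>"
  shows "e2ennreal x + e2ennreal y + e2ennreal (- (x + y))
       = e2ennreal (x + y) + (e2ennreal (- x) + e2ennreal (- y))"
proof (cases x; cases y)
  fix p q assume xy: "x = ereal p" "y = ereal q"
  have "max 0 p + max 0 q + max 0 (- (p + q)) = max 0 (p + q) + (max 0 (- p) + max 0 (- q))"
    by (simp add: max_def)
  then have "ennreal (max 0 p) + ennreal (max 0 q) + ennreal (max 0 (- (p + q)))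
      = ennreal (max 0 (p + q)) + (ennreal (max 0 (- p)) + ennreal (max 0 (- q)))"
    by (simp flip: ennreal_plus)
  then show ?thesis using xy by (simp add: ennreal_max_0)
qed (use assms in \<open>auto simp: e2ennreal_neg\<close>)

lemma circle_positive_part_finite:
  assumes "usc v" "\<And>z. v z < \<infinity>"
  shows "(\<integral>\<^sup>+t\<in>{0..2*pi}. e2ennreal (v (a + of_real r * cis t)) \<partial>lborel) < \<infinity>"
proof -
  have cont: "continuous_on {0..2*pi} (\<lambda>t. a + of_real r * cis t)"
    by (intro continuous_intros)
  obtain M :: nat where M: "\<forall>t\<in>{0..2*pi}. v (a + of_real r * cis t) \<le> ereal (real M)"
    using usc_bounded_above_on_compact[OF assms compact_continuous_image[OF cont compact_Icc]]
    by auto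
  have "(\<integral>\<^sup>+t\<in>{0..2*pi}. e2ennreal (v (a + of_real r * cis t)) \<partial>lborel)
      \<le> (\<integral>\<^sup>+t\<in>{0..2*pi}. ennreal (real M) \<partial>lborel)"
    using M by (intro nn_integral_mono)
      (auto simp: indicator_def e2ennreal_ereal[symmetric] simp del: e2ennreal_ereal intro!: e2ennreal_mono)
  also have "\<dots> < \<infinity>"
    by (simp add: nn_integral_cmult ennreal_mult_less_top)
  finally show ?thesis .
qed

text \<open>
  The circle mean is additive as long as the integrals of the negative parts are finite; positive
  parts always have a finite integral, because an upper semicontinuous function is bounded above on the
  circle. If a negative part has infinite integral, the corresponding mean is \<open>-\<infinity>\<close>, so the
  sub-mean-value inequality already forces the sum to be \<open>-\<infinity>\<close> at the centre.
\<close>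

lemma subharmonic_add:
  assumes v: "subharmonic v" and w: "subharmonic w"
  shows "subharmonic (\<lambda>z. v z + w z)"
  unfolding subharmonic_def
proof (intro conjI allI impI)
  have v': "usc v" "\<And>z. v z < \<infinity>" and w': "usc w" "\<And>z. w z < \<infinity>"
    using v w by (auto simp: subharmonic_def)
  show "usc (\<lambda>z. v z + w z)" using usc_add[OF v' w'] .
  show fin: "v z + w z < \<infinity>" for z using v'(2)[of z] w'(2)[of z] by auto
  fix a :: complex and r :: real assume r: "0 < r"
  define c where "c t = a + of_real r * cis t" for t
  define I where "I f = (\<integral>\<^sup>+t\<in>{0..2*pi}. e2ennreal (f (c t)) \<partial>lborel)" for f :: "complex \<Rightarrow> ereal"
  have mean: "circle_mean f a r = (enn2ereal (I f) - enn2ereal (I (\<lambda>z. - f z))) / ereal (2 * pi)" for f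
    by (simp add: circle_mean_def I_def c_def)
  have [measurable]: "c \<in> borel_measurable borel"
    unfolding c_def by (intro borel_measurable_continuous_onI continuous_intros)
  have [measurable]: "v \<in> borel_measurable borel" "w \<in> borel_measurable borel"
    using v' w' usc_borel_measurable by auto
  have parts: "I v + I w + I (\<lambda>z. - (v z + w z)) = I (\<lambda>z. v z + w z) + (I (\<lambda>z. - v z) + I (\<lambda>z. - w z))"
    unfolding I_def
    apply (subst nn_integral_add[symmetric], measurable)+
    apply (rule nn_integral_cong)
    subgoal for t
      using e2ennreal_add_parts[OF v'(2)[of "c t"] w'(2)[of "c t"]] by (simp flip: distrib_right)
    done
  have top: "I v < \<infinity>" "I w < \<infinity>" "I (\<lambda>z. v z + w z) < \<infinity>"
    unfolding I_def c_def
    using circle_positive_part_finite[OF v'] circle_positive_part_finite[OF w']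
      circle_positive_part_finite[OF \<open>usc (\<lambda>z. v z + w z)\<close> fin] by auto
  have le: "v a \<le> circle_mean v a r" "w a \<le> circle_mean w a r"
    using v w r by (auto simp: subharmonic_def)
  show "v a + w a \<le> circle_mean (\<lambda>z. v z + w z) a r"
  proof (cases "I (\<lambda>z. - v z) = \<infinity> \<or> I (\<lambda>z. - w z) = \<infinity>")
    case True
    then have "v a = -\<infinity> \<or> w a = -\<infinity>"
      using le top unfolding mean
      by (cases "I v"; cases "I w"; auto simp: top_ereal_def)
    then have "v a + w a = -\<infinity>"
      using v'(2)[of a] w'(2)[of a] by (cases "v a"; cases "w a") simp_all
    then show ?thesis by (simp only: ereal_less_eq)
  next
    case False
    obtain p1 where p1: "I v = ennreal p1" "0 \<le> p1" using top by (cases "I v") auto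
    obtain p2 where p2: "I w = ennreal p2" "0 \<le> p2" using top by (cases "I w") auto
    obtain p where p: "I (\<lambda>z. v z + w z) = ennreal p" "0 \<le> p"
      using top by (cases "I (\<lambda>z. v z + w z)") auto
    obtain n1 where n1: "I (\<lambda>z. - v z) = ennreal n1" "0 \<le> n1"
      using False by (cases "I (\<lambda>z. - v z)") auto
    obtain n2 where n2: "I (\<lambda>z. - w z) = ennreal n2" "0 \<le> n2"
      using False by (cases "I (\<lambda>z. - w z)") auto
    have "I (\<lambda>z. - (v z + w z)) \<le> I v + I w + I (\<lambda>z. - (v z + w z))" by simp
    also have "\<dots> < \<infinity>" unfolding parts p(1) n1(1) n2(1) by simp
    finally obtain n where n: "I (\<lambda>z. - (v z + w z)) = ennreal n" "0 \<le> n"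
      by (cases "I (\<lambda>z. - (v z + w z))") auto
    have "ennreal p1 + ennreal p2 + ennreal n = ennreal p + (ennreal n1 + ennreal n2)"
      using parts unfolding p1(1) p2(1) p(1) n1(1) n2(1) n(1) .
    then have "p1 + p2 + n = p + (n1 + n2)"
      using p1(2) p2(2) p(2) n1(2) n2(2) n(2) by (simp flip: ennreal_plus)
    then have "(p1 - n1) + (p2 - n2) = p - n" by simp
    then have "(p1 - n1) / (2 * pi) + (p2 - n2) / (2 * pi) = (p - n) / (2 * pi)"
      by (metis add_divide_distrib)
    moreover have "circle_mean v a r = ereal ((p1 - n1) / (2 * pi))"
      "circle_mean w a r = ereal ((p2 - n2) / (2 * pi))"
      "circle_mean (\<lambda>z. v z + w z) a r = ereal ((p - n) / (2 * pi))"
      using p1(2) p2(2) p(2) n1(2) n2(2) n(2)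
      by (simp_all add: mean p1(1) p2(1) p(1) n1(1) n2(1) n(1))
    ultimately show ?thesis
      using add_mono[OF le] by (simp only: plus_ereal.simps(1))
  qed
qed

lemma subharmonic_const: "subharmonic (\<lambda>z. ereal c)"
proof -
  have "(\<integral>\<^sup>+t\<in>{0..2*pi}. ennreal x \<partial>lborel) = ennreal (x * (2 * pi))" if "0 \<le> x" for x
    using that by (simp add: nn_integral_cmult ennreal_mult)
  then have "circle_mean (\<lambda>z. ereal c) a r = ereal c" for a r
    unfolding circle_mean_def
    using mult_nonpos_nonneg[of c "2 * pi"]
    by (cases "0 \<le> c") (auto simp: ennreal_neg zero_ennreal.rep_eq)
  then show ?thesis by (simp add: subharmonic_def usc_def)
qed

lemma psh_const: "psh (\<lambda>z. ereal c)"
  by (simp add: psh_def subharmonic_const usc_def)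

lemma psh_add:
  assumes "psh u" "psh v"
  shows "psh (\<lambda>z. u z + v z)"
  using assms unfolding psh_def by (auto intro: usc_add subharmonic_add)

lemma psh_affine_comp:
  assumes "psh u" "continuous_on UNIV A" "\<And>a b \<zeta>. A (a + \<zeta> *s b) = A a + \<zeta> *s B b"
  shows "psh (\<lambda>z. u (A z))"
  using assms unfolding psh_def by (auto intro: usc_continuous_comp)


section \<open>Vectors indexed by a disjoint sum\<close>

lemma vec_pair_nth [simp]:
  "vec_pair x y $ Inl i = x $ i" "vec_pair x y $ Inr j = y $ j"
  by (simp_all add: vec_pair_def)

lemma vec_sum_eq_iff:
  fixes x y :: "'a^('m::finite + 'n::finite)"
  shows "x = y \<longleftrightarrow> (\<forall>i. x $ Inl i = y $ Inl i) \<and> (\<forall>j. x $ Inr j = y $ Inr j)"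
  by (simp add: vec_eq_iff split_sum_all)

definition vec_left :: "'a^('m::finite + 'n::finite) \<Rightarrow> 'a^'m" where
  "vec_left z = (\<chi> i. z $ Inl i)"

definition vec_right :: "'a^('m::finite + 'n::finite) \<Rightarrow> 'a^'n" where
  "vec_right z = (\<chi> j. z $ Inr j)"

lemma vec_left_pair [simp]: "vec_left (vec_pair x y) = x"
  and vec_right_pair [simp]: "vec_right (vec_pair x y) = y"
  by (simp_all add: vec_left_def vec_right_def vec_eq_iff)

lemma vec_pair_left_right [simp]: "vec_pair (vec_left z) (vec_right z) = z"
  by (simp add: vec_sum_eq_iff vec_left_def vec_right_def)

lemma inner_vec_pair:
  fixes x :: "real^'m::finite" and y :: "real^'n::finite"
  shows "vec_pair x y \<bullet> vec_pair x' y' = x \<bullet> x' + y \<bullet> y'"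
  unfolding inner_vec_def
  by (subst UNIV_Plus_UNIV[symmetric], subst sum.Plus) auto

lemma continuous_vec_pair:
  assumes "continuous_on X f" "continuous_on X g"
  shows "continuous_on X (\<lambda>x. vec_pair (f x) (g x))"
  unfolding vec_pair_def
proof (intro continuous_on_vec_lambda)
  fix k
  show "continuous_on X (\<lambda>x. case k of Inl i \<Rightarrow> f x $ i | Inr j \<Rightarrow> g x $ j)"
    by (cases k) (simp_all add: continuous_on_component assms)
qed

lemma psh_slice_left:
  assumes "psh u"
  shows "psh (\<lambda>x. u (vec_pair x y))"
proof (rule psh_affine_comp[OF assms, where B = "\<lambda>b. vec_pair b 0"])
  show "continuous_on UNIV (\<lambda>x. vec_pair x y)"
    by (intro continuous_vec_pair continuous_intros)
qed (simp add: vec_sum_eq_iff)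

lemma psh_slice_right:
  assumes "psh u"
  shows "psh (\<lambda>y. u (vec_pair x y))"
proof (rule psh_affine_comp[OF assms, where B = "\<lambda>b. vec_pair 0 b"])
  show "continuous_on UNIV (\<lambda>y. vec_pair x y)"
    by (intro continuous_vec_pair continuous_intros)
qed (simp add: vec_sum_eq_iff)

lemma psh_comp_vec_left:
  assumes "psh u"
  shows "psh (\<lambda>z. u (vec_left z))"
proof (rule psh_affine_comp[OF assms, where B = vec_left])
  show "continuous_on UNIV (vec_left :: complex^('a + 'b) \<Rightarrow> _)"
    unfolding vec_left_def by (intro continuous_intros)
qed (simp add: vec_left_def vec_eq_iff)

lemma psh_comp_vec_right:
  assumes "psh u"
  shows "psh (\<lambda>z. u (vec_right z))"
proof (rule psh_affine_comp[OF assms, where B = vec_right])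
  show "continuous_on UNIV (vec_right :: complex^('b + 'a) \<Rightarrow> _)"
    unfolding vec_right_def by (intro continuous_intros)
qed (simp add: vec_right_def vec_eq_iff)

section \<open>The logarithmic supporting function\<close>

text \<open>
  Coordinates equal to 0 are sent to \<open>ln 0 = 0\<close>. This is the useful value here: such a coordinate
  is always paired with a vanishing exponent.
\<close>

definition Log :: "complex^'n::finite \<Rightarrow> real^'n" where
  "Log z = (\<chi> j. ln (cmod (z $ j)))"

text \<open>
  The exponents \<open>s\<close> for which the monomial \<open>|z|\<^sup>s = \<Prod> |z\<^sub>j|\<^bsup>s\<^sub>j\<^esup>\<close> is nonzero, with \<open>0\<^sup>0 = 1\<close>. If \<open>S\<close> is
  convex and lies in the nonnegative orthant, this is a face of \<open>S\<close> (possibly empty).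
\<close>

definition zero_face :: "(real^'n::finite) set \<Rightarrow> complex^'n \<Rightarrow> (real^'n) set" where
  "zero_face S z = {s \<in> S. \<forall>j. z $ j = 0 \<longrightarrow> s $ j = 0}"

text \<open>
  The tube lemma with a filter in place of the neighbourhoods of a point.
\<close>

lemma eventually_ball_compact:
  fixes S :: "'a::topological_space set"
  assumes "compact S" and "\<And>s. s \<in> S \<Longrightarrow> eventually (\<lambda>(s', w). P s' w) (nhds s \<times>\<^sub>F F)"
  shows "eventually (\<lambda>w. \<forall>s\<in>S. P s w) F"
proof -
  have "\<exists>U. open U \<and> s \<in> U \<and> eventually (\<lambda>w. \<forall>s'\<in>U. P s' w) F" if s: "s \<in> S" for s
  proof -
    obtain A B where AB: "eventually A (nhds s)" "eventually B F" "\<And>s' w. A s' \<Longrightarrow> B w \<Longrightarrow> P s' w"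
      using assms(2)[OF s] by (auto simp: eventually_prod_filter)
    then obtain U where "open U" "s \<in> U" "\<And>s'. s' \<in> U \<Longrightarrow> A s'"
      by (auto simp: eventually_nhds)
    with AB show ?thesis by (intro exI[of _ U]) (auto elim: eventually_mono)
  qed
  then obtain U where U: "\<And>s. s \<in> S \<Longrightarrow> open (U s) \<and> s \<in> U s \<and> eventually (\<lambda>w. \<forall>s'\<in>U s. P s' w) F"
    by metis
  obtain C where C: "C \<subseteq> S" "finite C" "S \<subseteq> (\<Union>s\<in>C. U s)"
    by (rule compactE_image[OF assms(1), of S U]) (use U in auto)
  have "eventually (\<lambda>w. \<forall>s\<in>C. \<forall>s'\<in>U s. P s' w) F"
    using C U by (intro eventually_ball_finite) auto
  then show ?thesis by (rule eventually_mono) (use C in blast)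
qed

text \<open>
  This makes the filter in the definition of the logarithmic supporting function nontrivial.
\<close>

lemma islimpt_Cstar:
  assumes "z \<notin> Cstar"
  shows "z islimpt (Cstar :: (complex^'n::finite) set)"
proof -
  define f :: "nat \<Rightarrow> complex^'n"
    where "f n = (\<chi> j. if z $ j = 0 then of_real (inverse (real (Suc n))) else z $ j)" for n
  have nz: "f n $ j \<noteq> 0" for n j
    by (simp add: f_def del: of_nat_Suc)
  have f: "f n \<in> Cstar - {z}" for n
  proof -
    have "f n \<in> Cstar" using nz by (simp add: Cstar_def)
    with assms show ?thesis by blast
  qed
  have "(\<lambda>n. f n $ j) \<longlonglongrightarrow> z $ j" for j
  proof (cases "z $ j = 0")
    case True
    have "(\<lambda>n. of_real (inverse (real (Suc n))) :: complex) \<longlonglongrightarrow> of_real 0"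
      by (rule tendsto_of_real[OF LIMSEQ_inverse_real_of_nat])
    with True show ?thesis by (simp add: f_def del: of_nat_Suc)
  next
    case False
    then show ?thesis by (simp add: f_def)
  qed
  then have "f \<longlonglongrightarrow> z" by (rule vec_tendstoI)
  with f show ?thesis unfolding islimpt_sequential by blast
qed

text \<open>
  By compactness it suffices to bound \<open>s' \<bullet> Log w\<close> for \<open>s'\<close> near a fixed \<open>s \<in> S\<close> and \<open>w\<close> near \<open>z\<close>.
  Let \<open>J\<close> be the set of coordinates in which \<open>z\<close> vanishes. Once \<open>|w\<^sub>j| \<le> e\<^sup>-\<^sup>T\<close> for all \<open>j \<in> J\<close>, the
  nonnegativity of exponents allows these logarithms to be replaced by \<open>-T\<close>, which gives an upper
  bound that is jointly continuous in \<open>s'\<close> and \<open>w\<close>. Its limit is below \<open>c\<close> by assumption if \<open>s\<close>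
  vanishes on \<open>J\<close>, and for large \<open>T\<close> otherwise.
\<close>

lemma eventually_supporting_fun_le:
  fixes S :: "(real^'n::finite) set"
  assumes S: "S \<subseteq> {x. \<forall>j. 0 \<le> x $ j}" "compact S"
    and c: "\<And>s. s \<in> zero_face S z \<Longrightarrow> s \<bullet> Log z < c"
  shows "\<forall>\<^sub>F w in at z within Cstar. supporting_fun S (Log w) \<le> ereal c"
proof -
  let ?F = "at z within Cstar"
  have "\<forall>\<^sub>F (s', w) in nhds s \<times>\<^sub>F ?F. s' \<in> S \<longrightarrow> s' \<bullet> Log w < c" if s: "s \<in> S" for s
  proof -
    define J where "J = {j. z $ j = 0}"
    define m where "m = (\<Sum>j\<in>J. s $ j)"
    have m: "0 \<le> m" unfolding m_def using S(1) s by (auto intro: sum_nonneg)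
    obtain T where T: "s \<bullet> Log z - T * m < c"
    proof (cases "m = 0")
      case True
      then have "s \<in> zero_face S z"
        using s S(1) unfolding m_def J_def zero_face_def
        by (subst (asm) sum_nonneg_eq_0_iff) auto
      then show ?thesis using c that[of 0] by simp
    next
      case False
      \<comment> \<open>this choice makes the left-hand side equal to \<open>c - 1\<close>\<close>
      with m show ?thesis
        by (intro that[of "(s \<bullet> Log z - c + 1) / m"]) simp
    qed
    define g where "g s' w = (\<Sum>j\<in>-J. s' $ j * ln (cmod (w $ j))) - T * (\<Sum>j\<in>J. s' $ j)"
      for s' :: "real^'n" and w :: "complex^'n"
    have "g s z = s \<bullet> Log z - T * m"
    proof -
      have "s \<bullet> Log z = (\<Sum>j\<in>-J. s $ j * ln (cmod (z $ j))) + (\<Sum>j\<in>J. s $ j * ln (cmod (z $ j)))"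
        unfolding inner_vec_def Log_def
        by (subst sum.union_disjoint[symmetric]) auto
      also have "(\<Sum>j\<in>J. s $ j * ln (cmod (z $ j))) = 0" by (simp add: J_def)
      finally show ?thesis by (simp add: g_def m_def)
    qed
    then have "g s z < c" using T by simp
    moreover have "((\<lambda>(s', w). g s' w) \<longlongrightarrow> g s z) (nhds s \<times>\<^sub>F ?F)"
    proof -
      have 1: "((\<lambda>p. fst p) \<longlongrightarrow> s) (nhds s \<times>\<^sub>F ?F)" by (rule filterlim_fst)
      have 2: "((\<lambda>p. snd p) \<longlongrightarrow> z) (nhds s \<times>\<^sub>F ?F)"
        by (rule filterlim_compose[OF tendsto_ident_at filterlim_snd])
      show ?thesis unfolding g_def case_prod_unfold
        by (intro tendsto_intros 1 2) (simp add: J_def)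
    qed
    ultimately have "\<forall>\<^sub>F (s', w) in nhds s \<times>\<^sub>F ?F. g s' w < c"
      unfolding case_prod_unfold by (rule order_tendstoD(2)[rotated])
    moreover have "\<forall>\<^sub>F (s', w) in nhds s \<times>\<^sub>F ?F. \<forall>j\<in>J. ln (cmod (w $ j)) \<le> - T"
    proof -
      have "\<forall>\<^sub>F w in ?F. cmod (w $ j) < exp (- T)" if "j \<in> J" for j
      proof (rule order_tendstoD(2))
        show "((\<lambda>w. cmod (w $ j)) \<longlongrightarrow> cmod (z $ j)) ?F" by (intro tendsto_intros)
      qed (use that in \<open>simp add: J_def\<close>)
      then have "\<forall>\<^sub>F w in ?F. \<forall>j\<in>J. cmod (w $ j) < exp (- T)"
        by (intro eventually_ball_finite) auto
      moreover have "\<forall>\<^sub>F w in ?F. w \<in> Cstar" by (simp add: eventually_at_filter)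
      ultimately have "\<forall>\<^sub>F w in ?F. \<forall>j\<in>J. ln (cmod (w $ j)) \<le> - T"
      proof eventually_elim
        case (elim w)
        show ?case
        proof
          fix j assume "j \<in> J"
          with elim have "0 < cmod (w $ j)" "cmod (w $ j) < exp (- T)" by (auto simp: Cstar_def)
          then have "ln (cmod (w $ j)) < ln (exp (- T))" by (subst ln_less_cancel_iff) auto
          then show "ln (cmod (w $ j)) \<le> - T" by simp
        qed
      qed
      then show ?thesis
        unfolding case_prod_unfold by (rule eventually_compose_filterlim[OF _ filterlim_snd])
    qed
    ultimately show ?thesis
    proof eventually_elim
      case (elim p)
      obtain s' w where p: "p = (s', w)" by fastforce
      show ?case unfolding p prod.case
      proof
        assume "s' \<in> S"
        have "s' \<bullet> Log w = (\<Sum>j\<in>-J. s' $ j * ln (cmod (w $ j))) + (\<Sum>j\<in>J. s' $ j * ln (cmod (w $ j)))"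
          unfolding inner_vec_def Log_def
          by (subst sum.union_disjoint[symmetric]) auto
        also have "(\<Sum>j\<in>J. s' $ j * ln (cmod (w $ j))) \<le> (\<Sum>j\<in>J. s' $ j * (- T))"
          using elim p \<open>s' \<in> S\<close> S(1) by (intro sum_mono mult_left_mono) auto
        also have "(\<Sum>j\<in>-J. s' $ j * ln (cmod (w $ j))) + \<dots> = g s' w"
          by (simp add: g_def sum_distrib_left sum_negf mult.commute)
        also have "\<dots> < c" using elim p by simp
        finally show "s' \<bullet> Log w < c" by simp
      qed
    qed
  qed
  from eventually_ball_compact[OF S(2) this]
  have "\<forall>\<^sub>F w in ?F. \<forall>s\<in>S. s \<in> S \<longrightarrow> s \<bullet> Log w < c" by simp
  then show ?thesis
    by eventually_elim (auto simp: supporting_fun_def intro!: SUP_least intro: less_imp_le)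
qed

text \<open>
  The lower bound holds because \<open>w \<mapsto> s \<bullet> Log w\<close> converges to \<open>s \<bullet> Log z\<close> for each \<open>s\<close> that vanishes
  where \<open>z\<close> does: the coordinates in which \<open>Log\<close> is discontinuous at \<open>z\<close> do not contribute.
\<close>

lemma log_supporting_fun_eq:
  fixes S :: "(real^'n::finite) set"
  assumes S: "S \<subseteq> {x. \<forall>j. 0 \<le> x $ j}" "compact S"
  shows "log_supporting_fun S z = supporting_fun (zero_face S z) (Log z)"
proof (cases "z \<in> Cstar")
  case True
  then have "zero_face S z = S" by (auto simp: zero_face_def Cstar_def)
  then show ?thesis using True by (simp add: log_supporting_fun_def Log_def)
next
  case False
  let ?F = "at z within (Cstar :: (complex^'n) set)"
  have nontriv: "?F \<noteq> bot" using islimpt_Cstar[OF False] by (simp add: trivial_limit_within)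
  have eq: "log_supporting_fun S z = Limsup ?F (\<lambda>w. supporting_fun S (Log w))"
    using False by (simp add: log_supporting_fun_def Log_def)
  show ?thesis
  proof (rule antisym)
    show "log_supporting_fun S z \<le> supporting_fun (zero_face S z) (Log z)"
    proof (rule dense_ge)
      fix d assume d: "supporting_fun (zero_face S z) (Log z) < d"
      obtain c :: real where c: "supporting_fun (zero_face S z) (Log z) < ereal c" "ereal c < d"
        using ereal_dense2[OF d] by blast
      have "s \<bullet> Log z < c" if "s \<in> zero_face S z" for s
      proof -
        have "ereal (s \<bullet> Log z) \<le> supporting_fun (zero_face S z) (Log z)"
          unfolding supporting_fun_def using that by (rule SUP_upper)
        with c(1) show ?thesis by (metis ereal_less(2) less_ereal.simps(1) order_le_less_trans)
      qed
      then have "Limsup ?F (\<lambda>w. supporting_fun S (Log w)) \<le> ereal c"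
        by (intro Limsup_bounded eventually_supporting_fun_le[OF S])
      with c(2) show "log_supporting_fun S z \<le> d" by (simp add: eq)
    qed
    show "supporting_fun (zero_face S z) (Log z) \<le> log_supporting_fun S z"
      unfolding supporting_fun_def[of "zero_face S z"]
    proof (rule SUP_least)
      fix s assume s: "s \<in> zero_face S z"
      have "((\<lambda>w. s $ j * ln (cmod (w $ j))) \<longlongrightarrow> s $ j * ln (cmod (z $ j))) ?F" for j
      proof (cases "z $ j = 0")
        case True
        then show ?thesis using s by (simp add: zero_face_def)
      next
        case False
        then show ?thesis by (intro tendsto_intros) auto
      qed
      then have "((\<lambda>w. s \<bullet> Log w) \<longlongrightarrow> s \<bullet> Log z) ?F"
        unfolding inner_vec_def Log_def by (auto intro!: tendsto_sum)
      then have "((\<lambda>w. ereal (s \<bullet> Log w)) \<longlongrightarrow> ereal (s \<bullet> Log z)) ?F" by simp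
      then have "ereal (s \<bullet> Log z) = Limsup ?F (\<lambda>w. ereal (s \<bullet> Log w))"
        using lim_imp_Limsup[OF nontriv] by metis
      also have "\<dots> \<le> Limsup ?F (\<lambda>w. supporting_fun S (Log w))"
        using s by (intro Limsup_mono always_eventually)
          (auto simp: supporting_fun_def zero_face_def intro: SUP_upper)
      finally show "ereal (s \<bullet> Log z) \<le> log_supporting_fun S z" by (simp add: eq)
    qed
  qed
qed

lemma log_supporting_fun_nonneg:
  assumes "S \<subseteq> {x. \<forall>j. 0 \<le> x $ j}" "compact S" "0 \<in> S"
  shows "0 \<le> log_supporting_fun S z"
  unfolding log_supporting_fun_eq[OF assms(1,2)] supporting_fun_def
  using assms(3) by (intro SUP_upper2[of 0]) (auto simp: zero_face_def)

lemma log_supporting_fun_finite: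
  assumes "S \<subseteq> {x. \<forall>j. 0 \<le> x $ j}" "compact S" "0 \<in> S"
  obtains c where "log_supporting_fun S z = ereal c"
proof -
  obtain R where R: "\<And>s. s \<in> S \<Longrightarrow> norm s \<le> R"
    using compact_imp_bounded[OF assms(2)] by (auto simp: bounded_iff)
  have "log_supporting_fun S z \<le> ereal (R * norm (Log z))"
    unfolding log_supporting_fun_eq[OF assms(1,2)] supporting_fun_def
  proof (rule SUP_least)
    fix s assume "s \<in> zero_face S z"
    then have "norm s \<le> R" using R by (auto simp: zero_face_def)
    then have "s \<bullet> Log z \<le> R * norm (Log z)"
      by (meson mult_right_mono norm_cauchy_schwarz norm_ge_zero order_trans)
    then show "ereal (s \<bullet> Log z) \<le> ereal (R * norm (Log z))" by simp
  qed
  then show ?thesis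
    using log_supporting_fun_nonneg[OF assms, of z] that by (cases "log_supporting_fun S z") auto
qed

lemma compact_vec_times:
  fixes A :: "(real^'m::finite) set" and B :: "(real^'n::finite) set"
  assumes "compact A" "compact B"
  shows "compact (vec_times A B)"
proof -
  have "vec_times A B = (\<lambda>p. vec_pair (fst p) (snd p)) ` (A \<times> B)"
    by (force simp: vec_times_def)
  then show ?thesis
    using assms by (auto intro!: compact_continuous_image compact_Times continuous_vec_pair continuous_intros)
qed

text \<open>
  The face of a product singled out by the zeros of \<open>(z\<^sub>1, z\<^sub>2)\<close> is the product of the faces singled out
  by the zeros of \<open>z\<^sub>1\<close> and \<open>z\<^sub>2\<close>, and the supremum of a sum over a product splits.
\<close>

lemma log_supporting_fun_vec_times:
  fixes S1 :: "(real^'m::finite) set" and S2 :: "(real^'n::finite) set"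
  assumes S1: "S1 \<subseteq> {x. \<forall>j. 0 \<le> x $ j}" "compact S1" "0 \<in> S1"
    and S2: "S2 \<subseteq> {x. \<forall>j. 0 \<le> x $ j}" "compact S2" "0 \<in> S2"
  shows "log_supporting_fun (vec_times S1 S2) (vec_pair z1 z2)
    = log_supporting_fun S1 z1 + log_supporting_fun S2 z2"
proof -
  let ?A = "zero_face S1 z1" and ?B = "zero_face S2 z2"
  have S: "vec_times S1 S2 \<subseteq> {x. \<forall>j. 0 \<le> x $ j}"
    using S1(1) S2(1) by (auto simp: vec_times_def split_sum_all dest!: subsetD)
  have face: "zero_face (vec_times S1 S2) (vec_pair z1 z2) = vec_times ?A ?B"
    unfolding zero_face_def vec_times_def
    by (auto simp: split_sum_all) blast
  have Log: "Log (vec_pair z1 z2) = vec_pair (Log z1) (Log z2)"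
    by (simp add: vec_sum_eq_iff Log_def)
  have ne: "?A \<noteq> {}" "?B \<noteq> {}" using S1(3) S2(3) by (auto simp: zero_face_def)
  have "supporting_fun (vec_times ?A ?B) (vec_pair (Log z1) (Log z2))
      = (SUP x\<in>?A. SUP y\<in>?B. ereal (x \<bullet> Log z1) + ereal (y \<bullet> Log z2))"
  proof -
    have "vec_times ?A ?B = (\<Union>x\<in>?A. vec_pair x ` ?B)" by (auto simp: vec_times_def)
    then show ?thesis
      by (simp add: supporting_fun_def SUP_UNION image_image inner_vec_pair)
  qed
  also have "\<dots> = (SUP x\<in>?A. ereal (x \<bullet> Log z1) + supporting_fun ?B (Log z2))"
    unfolding supporting_fun_def using ne by (simp add: SUP_ereal_add_right del: plus_ereal.simps)
  also have "\<dots> = supporting_fun ?A (Log z1) + supporting_fun ?B (Log z2)"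
  proof -
    have "supporting_fun ?B (Log z2) \<noteq> -\<infinity>"
      using log_supporting_fun_nonneg[OF S2, of z2] log_supporting_fun_eq[OF S2(1,2), of z2] by auto
    then show ?thesis
      unfolding supporting_fun_def[of ?A] using ne by (simp add: SUP_ereal_add_left)
  qed
  finally show ?thesis
    using log_supporting_fun_eq[OF S compact_vec_times[OF S1(2) S2(2)]] face Log
      log_supporting_fun_eq[OF S1(1,2)] log_supporting_fun_eq[OF S2(1,2)] by simp
qed

section \<open>Extremal functions of products\<close>

definition competitors :: "(real^'n::finite) set \<Rightarrow> (complex^'n) set \<Rightarrow> (complex^'n \<Rightarrow> ereal) set" where
  "competitors S K = {u \<in> Lelong_class S. \<forall>w\<in>K. u w \<le> 0}"

lemma competitor_le_extremal_fun: "u \<in> competitors S K \<Longrightarrow> u z \<le> extremal_fun S K z"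
  unfolding extremal_fun_def competitors_def by (rule SUP_upper)

lemma zero_competitor:
  assumes "S \<subseteq> {x. \<forall>j. 0 \<le> x $ j}" "compact S" "0 \<in> S"
  shows "(\<lambda>z. 0) \<in> competitors S K"
  using psh_const[of 0] log_supporting_fun_nonneg[OF assms]
  by (auto simp: competitors_def Lelong_class_def zero_ereal_def[symmetric] intro: exI[of _ 0])

lemma extremal_fun_nonneg:
  assumes "S \<subseteq> {x. \<forall>j. 0 \<le> x $ j}" "compact S" "0 \<in> S"
  shows "0 \<le> extremal_fun S K z"
  using competitor_le_extremal_fun[OF zero_competitor[OF assms]] .

lemma competitors_add:
  fixes S1 :: "(real^'m::finite) set" and S2 :: "(real^'n::finite) set"
  assumes S1: "S1 \<subseteq> {x. \<forall>j. 0 \<le> x $ j}" "compact S1" "0 \<in> S1"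
    and S2: "S2 \<subseteq> {x. \<forall>j. 0 \<le> x $ j}" "compact S2" "0 \<in> S2"
    and u: "u \<in> competitors S1 K1" and v: "v \<in> competitors S2 K2"
  shows "(\<lambda>z. u (vec_left z) + v (vec_right z)) \<in> competitors (vec_times S1 S2) (vec_times K1 K2)"
proof -
  obtain c d :: real where c: "\<And>x. u x \<le> log_supporting_fun S1 x + ereal c"
    and d: "\<And>y. v y \<le> log_supporting_fun S2 y + ereal d"
    using u v by (auto simp: competitors_def Lelong_class_def)
  have "u (vec_left z) + v (vec_right z) \<le> log_supporting_fun (vec_times S1 S2) z + ereal (c + d)" for z
  proof -
    have "u (vec_left z) + v (vec_right z)
      \<le> (log_supporting_fun S1 (vec_left z) + ereal c) + (log_supporting_fun S2 (vec_right z) + ereal d)"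
      by (intro add_mono c d)
    also have "\<dots> = log_supporting_fun (vec_times S1 S2) z + ereal (c + d)"
      using log_supporting_fun_vec_times[OF S1 S2, of "vec_left z" "vec_right z"]
      by (simp add: ac_simps flip: plus_ereal.simps(1))
    finally show ?thesis .
  qed
  moreover have "psh (\<lambda>z. u (vec_left z) + v (vec_right z))"
    using u v by (intro psh_add psh_comp_vec_left psh_comp_vec_right)
      (auto simp: competitors_def Lelong_class_def)
  moreover have "u x + v y \<le> 0" if "x \<in> K1" "y \<in> K2" for x y
    using u v that by (auto simp: competitors_def intro!: add_nonpos_nonpos)
  ultimately show ?thesis
    by (auto simp: competitors_def Lelong_class_def vec_times_def)
qed

text \<open>
  The two suprema are moved across the sum one at a time. Moving the first one needs
  \<open>v(z\<^sub>2) \<noteq> -\<infinity>\<close>, since \<open>\<infinity> + (-\<infinity>) = \<infinity>\<close> in the extended reals; a competitor \<open>v\<close> with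
  \<open>v(z\<^sub>2) = -\<infinity>\<close> is covered by comparing with the competitor 0.
\<close>

lemma extremal_fun_add_le:
  fixes S1 :: "(real^'m::finite) set" and S2 :: "(real^'n::finite) set"
  assumes S1: "S1 \<subseteq> {x. \<forall>j. 0 \<le> x $ j}" "compact S1" "0 \<in> S1"
    and S2: "S2 \<subseteq> {x. \<forall>j. 0 \<le> x $ j}" "compact S2" "0 \<in> S2"
  shows "extremal_fun S1 K1 z1 + extremal_fun S2 K2 z2
    \<le> extremal_fun (vec_times S1 S2) (vec_times K1 K2) (vec_pair z1 z2)" (is "?V1 + ?V2 \<le> ?V")
proof -
  have V1: "?V1 = (SUP u\<in>competitors S1 K1. u z1)" and V2: "?V2 = (SUP v\<in>competitors S2 K2. v z2)"
    by (simp_all add: extremal_fun_def competitors_def)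
  have ne: "competitors S1 K1 \<noteq> {}" "competitors S2 K2 \<noteq> {}"
    using zero_competitor[OF S1] zero_competitor[OF S2] by blast+
  have sum: "u z1 + v z2 \<le> ?V" if "u \<in> competitors S1 K1" "v \<in> competitors S2 K2" for u v
    using competitor_le_extremal_fun[OF competitors_add[OF S1 S2 that], of "vec_pair z1 z2"] by simp
  have V1_add: "?V1 + v z2 \<le> ?V" if "v \<in> competitors S2 K2" "v z2 \<noteq> -\<infinity>" for v
    unfolding V1 using sum that ne by (subst SUP_ereal_add_left[symmetric]) (auto intro: SUP_least)
  have V1_le: "?V1 \<le> ?V"
    using V1_add[OF zero_competitor[OF S2]] by simp
  have "?V1 + v z2 \<le> ?V" if "v \<in> competitors S2 K2" for v
    using V1_add[OF that] V1_le by (cases "v z2 = -\<infinity>"; cases ?V1) auto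
  moreover have "?V1 \<noteq> -\<infinity>" using extremal_fun_nonneg[OF S1, of K1 z1] by auto
  ultimately show ?thesis
    unfolding V2 using ne by (subst SUP_ereal_add_right[symmetric]) (auto intro: SUP_least)
qed

lemma competitor_slice_left:
  fixes S1 :: "(real^'m::finite) set" and S2 :: "(real^'n::finite) set"
  assumes S1: "S1 \<subseteq> {x. \<forall>j. 0 \<le> x $ j}" "compact S1" "0 \<in> S1"
    and S2: "S2 \<subseteq> {x. \<forall>j. 0 \<le> x $ j}" "compact S2" "0 \<in> S2"
    and u: "u \<in> competitors (vec_times S1 S2) (vec_times K1 K2)" and y: "y \<in> K2"
  shows "(\<lambda>x. u (vec_pair x y)) \<in> competitors S1 K1"
proof -
  obtain c :: real where c: "\<And>z. u z \<le> log_supporting_fun (vec_times S1 S2) z + ereal c"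
    using u by (auto simp: competitors_def Lelong_class_def)
  obtain h where h: "log_supporting_fun S2 y = ereal h"
    using log_supporting_fun_finite[OF S2] .
  have "u (vec_pair x y) \<le> log_supporting_fun S1 x + ereal (h + c)" for x
    using c[of "vec_pair x y"] log_supporting_fun_vec_times[OF S1 S2, of x y] h
    by (simp add: add.assoc)
  then show ?thesis
    using u y psh_slice_left[of u y]
    by (auto simp: competitors_def Lelong_class_def vec_times_def)
qed

text \<open>
  For \<open>y \<in> K\<^sub>2\<close> the slice \<open>u(\<cdot>, y)\<close> is itself a competitor on the first factor, hence at most \<open>b\<close> at \<open>x\<close>.
\<close>

lemma competitor_slice_right_minus:
  fixes S1 :: "(real^'m::finite) set" and S2 :: "(real^'n::finite) set"
  assumes S1: "S1 \<subseteq> {x. \<forall>j. 0 \<le> x $ j}" "compact S1" "0 \<in> S1"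
    and S2: "S2 \<subseteq> {x. \<forall>j. 0 \<le> x $ j}" "compact S2" "0 \<in> S2"
    and u: "u \<in> competitors (vec_times S1 S2) (vec_times K1 K2)"
    and V1: "extremal_fun S1 K1 x = ereal b"
  shows "(\<lambda>y. u (vec_pair x y) + ereal (- b)) \<in> competitors S2 K2"
proof -
  obtain c :: real where c: "\<And>z. u z \<le> log_supporting_fun (vec_times S1 S2) z + ereal c"
    using u by (auto simp: competitors_def Lelong_class_def)
  obtain h where h: "log_supporting_fun S1 x = ereal h"
    using log_supporting_fun_finite[OF S1] .
  have "u (vec_pair x y) + ereal (- b) \<le> log_supporting_fun S2 y + ereal (h + c - b)" for y
  proof -
    obtain k where k: "log_supporting_fun S2 y = ereal k"
      using log_supporting_fun_finite[OF S2] .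
    have "u (vec_pair x y) \<le> ereal (h + k + c)"
      using c[of "vec_pair x y"] log_supporting_fun_vec_times[OF S1 S2, of x y] h k by simp
    then show ?thesis using k by (cases "u (vec_pair x y)") auto
  qed
  moreover have "u (vec_pair x y) + ereal (- b) \<le> 0" if "y \<in> K2" for y
    using competitor_le_extremal_fun[OF competitor_slice_left[OF S1 S2 u that], of x] V1
    by (cases "u (vec_pair x y)") auto
  moreover have "psh (\<lambda>y. u (vec_pair x y) + ereal (- b))"
    using u by (intro psh_add psh_const psh_slice_right) (auto simp: competitors_def Lelong_class_def)
  ultimately show ?thesis
    unfolding competitors_def Lelong_class_def by blast
qed

lemma extremal_fun_le_add:
  fixes S1 :: "(real^'m::finite) set" and S2 :: "(real^'n::finite) set"
  assumes S1: "S1 \<subseteq> {x. \<forall>j. 0 \<le> x $ j}" "compact S1" "0 \<in> S1"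
    and S2: "S2 \<subseteq> {x. \<forall>j. 0 \<le> x $ j}" "compact S2" "0 \<in> S2"
  shows "extremal_fun (vec_times S1 S2) (vec_times K1 K2) (vec_pair z1 z2)
    \<le> extremal_fun S1 K1 z1 + extremal_fun S2 K2 z2"
proof (cases "extremal_fun S1 K1 z1")
  case (real b)
  have "u (vec_pair z1 z2) \<le> extremal_fun S1 K1 z1 + extremal_fun S2 K2 z2"
    if "u \<in> competitors (vec_times S1 S2) (vec_times K1 K2)" for u
  proof -
    have "u (vec_pair z1 z2) + ereal (- b) \<le> extremal_fun S2 K2 z2"
      using competitor_le_extremal_fun[OF competitor_slice_right_minus[OF S1 S2 that real]] .
    then show ?thesis
      using real by (cases "u (vec_pair z1 z2)"; cases "extremal_fun S2 K2 z2") auto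
  qed
  then show ?thesis
    unfolding extremal_fun_def[of "vec_times S1 S2"] competitors_def by (intro SUP_least) auto
next
  case PInf
  then show ?thesis by simp
next
  case MInf
  then show ?thesis using extremal_fun_nonneg[OF S1, of K1 z1] by simp
qed

theorem corollary1p4:
  fixes K1 :: "(complex^'n1::finite) set" and K2 :: "(complex^'n2::finite) set"
    and S1 :: "(real^'n1) set" and S2 :: "(real^'n2) set"
    and z1 :: "complex^'n1" and z2 :: "complex^'n2"
  assumes "compact K1" and "\<not> pluripolar K1"
    and "compact K2" and "\<not> pluripolar K2"
    and "S1 \<subseteq> {x. \<forall>j. 0 \<le> x $ j}" and "compact S1" and "convex S1" and "0 \<in> S1"
    and "S2 \<subseteq> {x. \<forall>j. 0 \<le> x $ j}" and "compact S2" and "convex S2" and "0 \<in> S2"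
  shows "extremal_fun (vec_times S1 S2) (vec_times K1 K2) (vec_pair z1 z2)
           = extremal_fun S1 K1 z1 + extremal_fun S2 K2 z2"
  using extremal_fun_le_add[OF assms(5,6,8,9,10,12)] extremal_fun_add_le[OF assms(5,6,8,9,10,12)]
  by (rule antisym)

end
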